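(* $f_2(n,C_6)=\Omega(n^{4/3})$, where $C_6$ is the cycle of length $6$.
   Context: All colourings are edge-colourings of the complete graph $K_n$; a colouring is proper if any two edges sharing a vertex receive different colours. Two copies of a graph $H$ in an edge-coloured $K_n$ are colour isomorphic if there is a graph isomorphism between them mapping each edge to an edge of the same colour. A $2$-repeat of $H$ is a pair of vertex-disjoint colour-isomorphic copies of $H$. For $n\geq 2$ and a graph $H$, $f_2(n,H)$ is the smallest integer $C$ such that there is a proper edge-colouring of $K_n$ with $C$ colours containing no $2$-repeat of $H$. Asymptotic notation is with respect to $n\to\infty$. *)

theory Defs
  imports Complex_Main "HOL-Library.Landau_Symbols"
begin

record 'a ugraph =
  verts :: "'a set"
  edges :: "'a set set"

definition simple_graph :: "'a ugraph \<Rightarrow> bool" where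
  "simple_graph G \<longleftrightarrow> (\<forall>e\<in>edges G. e \<subseteq> verts G \<and> card e = 2)"

definition complete_graph :: "nat \<Rightarrow> nat ugraph" where
  "complete_graph n = \<lparr>verts = {..<n}, edges = {e. e \<subseteq> {..<n} \<and> card e = 2}\<rparr>"

text \<open>The cycle of length \<open>k\<close>, meaningful for \<open>k \<ge> 3\<close>.\<close>

definition cycle_graph :: "nat \<Rightarrow> nat ugraph" where
  "cycle_graph k = \<lparr>verts = {..<k}, edges = {{i, Suc i mod k} |i. i < k}\<rparr>"

definition graph_iso :: "('a \<Rightarrow> 'b) \<Rightarrow> 'a ugraph \<Rightarrow> 'b ugraph \<Rightarrow> bool" where
  "graph_iso \<phi> G H \<longleftrightarrow> bij_betw \<phi> (verts G) (verts H) \<and>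
     (\<forall>u\<in>verts G. \<forall>v\<in>verts G. {u, v} \<in> edges G \<longleftrightarrow> {\<phi> u, \<phi> v} \<in> edges H)"

text \<open>Copies are subgraphs, not necessarily induced.\<close>

definition is_copy :: "'b ugraph \<Rightarrow> 'a ugraph \<Rightarrow> 'a ugraph \<Rightarrow> bool" where
  "is_copy H A G \<longleftrightarrow> simple_graph A \<and> verts A \<subseteq> verts G \<and> edges A \<subseteq> edges G \<and>
     (\<exists>\<phi>. graph_iso \<phi> H A)"

definition proper_colouring :: "'a ugraph \<Rightarrow> ('a set \<Rightarrow> 'c) \<Rightarrow> bool" where
  "proper_colouring G c \<longleftrightarrow>
     (\<forall>e\<in>edges G. \<forall>e'\<in>edges G. e \<noteq> e' \<and> e \<inter> e' \<noteq> {} \<longrightarrow> c e \<noteq> c e')"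

definition colour_isomorphic :: "('a set \<Rightarrow> 'c) \<Rightarrow> 'a ugraph \<Rightarrow> 'a ugraph \<Rightarrow> bool" where
  "colour_isomorphic c A B \<longleftrightarrow>
     (\<exists>\<phi>. graph_iso \<phi> A B \<and> (\<forall>e\<in>edges A. c (\<phi> ` e) = c e))"

definition has_two_repeat :: "'a ugraph \<Rightarrow> ('a set \<Rightarrow> 'c) \<Rightarrow> 'b ugraph \<Rightarrow> bool" where
  "has_two_repeat G c H \<longleftrightarrow>
     (\<exists>A B. is_copy H A G \<and> is_copy H B G \<and> verts A \<inter> verts B = {} \<and> colour_isomorphic c A B)"

text \<open>The palette size \<open>C\<close> is the number of colours that actually occur. If \<open>H\<close> is a simple graph with an edge, the
  set of admissible \<open>C\<close> is nonempty: giving all edges of the complete graph distinct colours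
  creates no 2-repeat.\<close>

definition f2 :: "nat \<Rightarrow> 'b ugraph \<Rightarrow> nat" where
  "f2 n H = (LEAST C. \<exists>c :: nat set \<Rightarrow> nat.
     proper_colouring (complete_graph n) c \<and>
     card (c ` edges (complete_graph n)) = C \<and>
     \<not> has_two_repeat (complete_graph n) c H)"

end

theory Submission
  imports Defs "HOL-Analysis.Convex"
begin

text \<open>
  Fix a proper colouring and consider the auxiliary graph whose vertices are the ordered pairs of
  distinct vertices of \<open>K\<^sub>n\<close>, where \<open>(u, v)\<close> and \<open>(u', v')\<close> are adjacent if all four vertices are
  distinct and \<open>uu'\<close>, \<open>vv'\<close> have the same colour. A 6-cycle of pairwise disjoint pairs in it is a
  2-repeat of \<open>C\<^sub>6\<close>. With \<open>C\<close> colours the average degree is at least about \<open>n\<^sup>2 / C\<close>, so some subgraph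
  has minimum degree \<open>d\<close> of this order. Properness leaves each vertex at most 4 neighbours that meet
  a given pair.

  In such a graph on \<open>N\<close> vertices, weight each closed walk by the product of the inverse degrees of
  its vertices, and let \<open>h\<^sub>k\<close> be the total weight of the closed walks of length \<open>k\<close>. Then
  \<open>h\<^sub>2 \<le> N / d\<close> and \<open>h\<^sub>6 \<ge> 1\<close>, while the closed 6-walks in which two given non-consecutive vertices
  conflict have weight at most \<open>(4 / d) h\<^sub>4\<close>. If every closed 6-walk has one of the 9 possible
  conflicts, then \<open>h\<^sub>6 \<le> (36 / d) h\<^sub>4\<close>; with \<open>h\<^sub>4\<^sup>2 \<le> h\<^sub>2 h\<^sub>6\<close> this gives \<open>h\<^sub>4 \<le> (36 / d) h\<^sub>2\<close> and finally
  \<open>d\<^sup>3 \<le> 36\<^sup>2 N\<close>. As \<open>N \<le> n\<^sup>2\<close>, this means \<open>C = \<Omega>(n\<^bsup>4/3\<^esup>)\<close>. The inverse degree weights make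
  an upper bound on the degrees unnecessary.
\<close>

section \<open>Conflict-free hexagons in weighted walks\<close>

lemma mult_le_mean_squares: "p * q \<le> (p\<^sup>2 + q\<^sup>2) / 2" for p q :: real
  using sum_squares_bound[of p q] by simp

lemma sum_reverse3:
  "(\<Sum>x\<in>A. \<Sum>y\<in>B. \<Sum>z\<in>C. f x y z) = (\<Sum>z\<in>C. \<Sum>y\<in>B. \<Sum>x\<in>A. f x y z)"
proof -
  have "(\<Sum>x\<in>A. \<Sum>y\<in>B. \<Sum>z\<in>C. f x y z) = (\<Sum>y\<in>B. \<Sum>x\<in>A. \<Sum>z\<in>C. f x y z)"
    by (rule sum.swap)
  also have "\<dots> = (\<Sum>y\<in>B. \<Sum>z\<in>C. \<Sum>x\<in>A. f x y z)"
    by (rule sum.cong[OF refl], rule sum.swap)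
  also have "\<dots> = (\<Sum>z\<in>C. \<Sum>y\<in>B. \<Sum>x\<in>A. f x y z)"
    by (rule sum.swap)
  finally show ?thesis .
qed

lemma sum_rotate6:
  "(\<Sum>x0\<in>S. \<Sum>x1\<in>S. \<Sum>x2\<in>S. \<Sum>x3\<in>S. \<Sum>x4\<in>S. \<Sum>x5\<in>S. f x0 x1 x2 x3 x4 x5) =
   (\<Sum>x0\<in>S. \<Sum>x1\<in>S. \<Sum>x2\<in>S. \<Sum>x3\<in>S. \<Sum>x4\<in>S. \<Sum>x5\<in>S. f x1 x2 x3 x4 x5 x0)"
  unfolding sum.cartesian_product
  by (rule sum.reindex_bij_witness[where
        i = "\<lambda>(x0, x1, x2, x3, x4, x5). (x1, x2, x3, x4, x5, x0)" and
        j = "\<lambda>(x0, x1, x2, x3, x4, x5). (x5, x0, x1, x2, x3, x4)"]) auto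

text \<open>Intended for \<open>S\<close> a set of ordered pairs, \<open>adj\<close> the auxiliary
  adjacency and \<open>sim\<close> the relation of sharing a vertex. By \<open>adj_not_sim\<close>
  only the 9 non-consecutive pairs of a closed 6-walk can conflict: 6 at distance 2 and 3 opposite
  ones.\<close>

locale conflict_graph =
  fixes S :: "'a set" and adj sim :: "'a \<Rightarrow> 'a \<Rightarrow> bool" and s d :: real
  assumes finite_S: "finite S" and S_nonempty: "S \<noteq> {}"
    and adj_sym: "adj x y \<Longrightarrow> adj y x"
    and sim_sym: "sim x y \<Longrightarrow> sim y x"
    and adj_not_sim: "adj x y \<Longrightarrow> \<not> sim x y"
    and d_pos: "d > 0" and s_pos: "s > 0"
    and min_degree: "x \<in> S \<Longrightarrow> d \<le> card {y\<in>S. adj x y}"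
    and few_conflicts: "x \<in> S \<Longrightarrow> y \<in> S \<Longrightarrow> card {z\<in>S. adj x z \<and> sim z y} \<le> s"
begin

section \<open>Closed walks with inverse degree weights\<close>

definition a :: "'a \<Rightarrow> 'a \<Rightarrow> real" where "a x y = of_bool (adj x y)"
definition g :: "'a \<Rightarrow> 'a \<Rightarrow> real" where "g x y = of_bool (sim x y)"
definition deg :: "'a \<Rightarrow> real" where "deg x = (\<Sum>y\<in>S. a x y)"
definition w :: "'a \<Rightarrow> real" where "w x = 1 / deg x"
text \<open>Only inner vertices carry a weight, so that walks can be glued at their ends with each
  end weighted once.\<close>

definition walk2 :: "'a \<Rightarrow> 'a \<Rightarrow> real" where
  "walk2 x y = (\<Sum>z\<in>S. a x z * w z * a z y)"
definition walk3 :: "'a \<Rightarrow> 'a \<Rightarrow> real" where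
  "walk3 x y = (\<Sum>z\<in>S. a x z * w z * walk2 z y)"
text \<open>The closed walks of length 4 and 6 are grouped by two opposite vertices.\<close>

definition closed2 :: real where "closed2 = (\<Sum>x\<in>S. \<Sum>y\<in>S. w x * w y * a x y)"
definition closed4 :: real where "closed4 = (\<Sum>x\<in>S. \<Sum>y\<in>S. w x * w y * (walk2 x y)\<^sup>2)"
definition closed6 :: real where "closed6 = (\<Sum>x\<in>S. \<Sum>y\<in>S. w x * w y * (walk3 x y)\<^sup>2)"

lemma a_sym: "a x y = a y x"
  unfolding a_def using adj_sym by (metis of_bool_eq_iff)

lemma g_sym: "g x y = g y x"
  unfolding g_def using sim_sym by (metis of_bool_eq_iff)

lemma a_nonneg [simp]: "0 \<le> a x y" and a_square [simp]: "(a x y)\<^sup>2 = a x y"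
  by (auto simp: a_def)

lemma g_nonneg [simp]: "0 \<le> g x y"
  by (auto simp: g_def)

lemma not_sim_iff: "\<not> sim x y \<longleftrightarrow> g x y < 1"
  by (simp add: g_def)

lemma deg_card: "deg x = card {y\<in>S. adj x y}"
  using finite_S by (simp add: deg_def a_def sum.If_cases Int_def of_bool_def)

lemma deg_ge: "x \<in> S \<Longrightarrow> d \<le> deg x"
  using min_degree by (simp add: deg_card)

lemma deg_pos: "x \<in> S \<Longrightarrow> 0 < deg x"
  using deg_ge d_pos by force

lemma deg_nonneg [simp]: "0 \<le> deg x"
  by (simp add: deg_card)

lemma w_nonneg [simp]: "0 \<le> w x"
  by (simp add: w_def)

lemma w_deg: "x \<in> S \<Longrightarrow> w x * deg x = 1"
  using deg_pos by (fastforce simp: w_def)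

lemma w_le: "x \<in> S \<Longrightarrow> w x \<le> 1 / d"
  using deg_ge[of x] d_pos by (simp add: w_def frac_le)

lemma sum_a: "(\<Sum>y\<in>S. a x y) = deg x" "(\<Sum>y\<in>S. a y x) = deg x"
  using a_sym by (simp_all add: deg_def)

lemma sum_a_g:
  assumes "x \<in> S" "y \<in> S"
  shows "(\<Sum>z\<in>S. a x z * g z y) \<le> s"
proof -
  have "(\<Sum>z\<in>S. a x z * g z y) = card {z\<in>S. adj x z \<and> sim z y}"
    using finite_S
    by (simp add: a_def g_def of_bool_conj[symmetric] del: of_bool_conj)
       (simp add: of_bool_def sum.If_cases Int_def)
  then show ?thesis
    using few_conflicts assms by simp
qed

lemma walk2_nonneg [simp]: "0 \<le> walk2 x y"
  by (simp add: walk2_def sum_nonneg)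

lemma walk2_sym: "walk2 x y = walk2 y x"
  unfolding walk2_def by (intro sum.cong) (auto simp: a_sym mult_ac)

lemma walk3_sym: "walk3 x y = walk3 y x"
proof -
  have "walk3 x y = (\<Sum>z\<in>S. \<Sum>t\<in>S. a x z * w z * (a z t * w t * a t y))"
    by (simp add: walk3_def walk2_def sum_distrib_left)
  also have "\<dots> = (\<Sum>t\<in>S. \<Sum>z\<in>S. a y t * w t * (a t z * w z * a z x))"
    by (subst sum.swap) (intro sum.cong refl, simp add: a_sym mult_ac)
  finally show ?thesis
    by (simp add: walk3_def walk2_def sum_distrib_left)
qed

lemma closed2_le: "closed2 \<le> card S / d"
proof -
  have "closed2 \<le> (\<Sum>x\<in>S. \<Sum>y\<in>S. w x * (1 / d) * a x y)"
    unfolding closed2_def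
    by (intro sum_mono mult_right_mono mult_left_mono) (auto simp: w_le)
  also have "\<dots> = (\<Sum>x\<in>S. (w x * deg x) * (1 / d))"
    by (rule sum.cong[OF refl], simp only: sum_distrib_left[symmetric] sum_a) simp
  also have "\<dots> = card S / d"
    by (simp add: w_deg)
  finally show ?thesis .
qed

text \<open>The weight \<open>w z\<close> cancels the row sum \<open>deg z\<close> of the last step,
  so lengthening a walk preserves row sums.\<close>

lemma sum_walk2: "(\<Sum>y\<in>S. walk2 x y) = deg x"
proof -
  have "(\<Sum>y\<in>S. walk2 x y) = (\<Sum>z\<in>S. a x z * (w z * deg z))"
    unfolding walk2_def by (subst sum.swap) (simp add: sum_a mult.assoc flip: sum_distrib_left)
  then show ?thesis
    by (simp add: w_deg sum_a)
qed

lemma sum_walk3: "(\<Sum>y\<in>S. walk3 x y) = deg x"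
proof -
  have "(\<Sum>y\<in>S. walk3 x y) = (\<Sum>z\<in>S. a x z * (w z * deg z))"
    unfolding walk3_def by (subst sum.swap) (simp add: sum_walk2 mult.assoc flip: sum_distrib_left)
  then show ?thesis
    by (simp add: w_deg sum_a)
qed

text \<open>In matrix terms \<open>closed6\<close> is the trace of the sixth power of the normalised
  adjacency matrix, which has eigenvalue 1. The elementary version subtracts from
  \<open>walk3 x y\<close> the contribution \<open>deg x * deg y / M\<close> of that eigenvector and
  uses that the weighted square of the difference is nonnegative.\<close>

lemma closed6_ge_1: "1 \<le> closed6"
proof -
  define M where "M = (\<Sum>x\<in>S. deg x)"
  have M: "M > 0"
    unfolding M_def using finite_S S_nonempty deg_pos by (intro sum_pos) auto
  have "2 / M * walk3 x y - deg x * deg y / M\<^sup>2 \<le> w x * w y * (walk3 x y)\<^sup>2"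
    if "x \<in> S" "y \<in> S" for x y
  proof -
    have "0 \<le> w x * w y * (walk3 x y - deg x * deg y / M)\<^sup>2"
      by simp
    also have "\<dots> = w x * w y * (walk3 x y)\<^sup>2 - 2 / M * walk3 x y * (w x * deg x) * (w y * deg y)
        + (w x * deg x) * (w y * deg y) * deg x * deg y / M\<^sup>2"
      by (simp add: power2_diff power_divide power_mult_distrib) (simp add: algebra_simps power2_eq_square)
    finally show ?thesis
      using that by (simp add: w_deg)
  qed
  then have "(\<Sum>x\<in>S. \<Sum>y\<in>S. 2 / M * walk3 x y - deg x * deg y / M\<^sup>2) \<le> closed6"
    unfolding closed6_def by (intro sum_mono)
  also have "(\<Sum>x\<in>S. \<Sum>y\<in>S. 2 / M * walk3 x y - deg x * deg y / M\<^sup>2)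
      = 2 / M * M - M * M / M\<^sup>2"
  proof -
    have "(\<Sum>x\<in>S. \<Sum>y\<in>S. 2 / M * walk3 x y) = 2 / M * M"
      by (simp only: sum_distrib_left[symmetric] sum_walk3 M_def[symmetric])
    moreover have "(\<Sum>x\<in>S. \<Sum>y\<in>S. deg x * deg y / M\<^sup>2) = M * M / M\<^sup>2"
      by (simp only: sum_divide_distrib[symmetric] sum_product[symmetric] M_def[symmetric])
    ultimately show ?thesis
      by (simp only: sum_subtractf)
  qed
  also have "\<dots> = 1"
    using M by (simp add: power2_eq_square)
  finally show ?thesis .
qed

text \<open>A closed walk of length 4 is also an edge together with a walk of length 3.\<close>

lemma closed4_eq: "closed4 = (\<Sum>x\<in>S. \<Sum>y\<in>S. w x * w y * (a x y * walk3 x y))"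
proof -
  have "closed4 = (\<Sum>x\<in>S. \<Sum>y\<in>S. \<Sum>z\<in>S. w x * w y * walk2 x y * (a x z * w z * a z y))"
    unfolding closed4_def
    by (simp add: power2_eq_square walk2_def[of _ _] sum_distrib_left mult.assoc)
       (simp add: walk2_def sum_distrib_left sum_distrib_right mult_ac)
  also have "\<dots> = (\<Sum>x\<in>S. \<Sum>z\<in>S. \<Sum>y\<in>S. w x * w y * walk2 x y * (a x z * w z * a z y))"
    by (rule sum.cong[OF refl], rule sum.swap)
  also have "\<dots> = (\<Sum>x\<in>S. \<Sum>z\<in>S. w x * w z * (a x z * walk3 z x))"
    unfolding walk3_def sum_distrib_left
    by (intro sum.cong refl) (simp add: walk2_sym mult_ac)
  finally show ?thesis
    by (simp add: walk3_sym)
qed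

text \<open>Cauchy-Schwarz for \<open>closed4\<close> against \<open>closed2\<close> and
  \<open>closed6\<close>, in its AM-GM form: \<open>closed4_eq\<close> pairs \<open>a x y\<close>
  with \<open>walk3 x y\<close>. The free parameter \<open>t\<close> avoids square roots.\<close>

lemma closed4_le:
  assumes "t > 0"
  shows "2 * closed4 \<le> t * closed2 + closed6 / t"
proof -
  have "2 * closed4 = (\<Sum>x\<in>S. \<Sum>y\<in>S. w x * w y * (2 * a x y * walk3 x y))"
    unfolding closed4_eq sum_distrib_left by (intro sum.cong refl) simp
  also have "\<dots> \<le> (\<Sum>x\<in>S. \<Sum>y\<in>S. w x * w y * (t * a x y + (walk3 x y)\<^sup>2 / t))"
  proof (intro sum_mono mult_left_mono)
    fix x y
    have "0 \<le> (t * a x y - walk3 x y)\<^sup>2 / t"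
      using assms by simp
    also have "\<dots> = t * (a x y)\<^sup>2 - 2 * a x y * walk3 x y + (walk3 x y)\<^sup>2 / t"
      using assms by (simp add: power2_diff field_simps power2_eq_square)
    finally show "2 * a x y * walk3 x y \<le> t * a x y + (walk3 x y)\<^sup>2 / t"
      by simp
  qed simp
  also have "\<dots> = t * closed2 + closed6 / t"
    unfolding closed2_def closed6_def sum_distrib_left sum_divide_distrib
    by (simp add: distrib_left sum.distrib mult_ac)
  finally show ?thesis .
qed

text \<open>
  One factor \<open>walk3 x y\<close> is split at its second vertex \<open>z\<close>. By AM-GM the sum is at most the mean of
  itself and of a sum in which \<open>x\<close> only has to be a neighbour of \<open>z\<close> in conflict with \<open>y\<close>.
\<close>

lemma conflict3_le:
  "(\<Sum>x\<in>S. \<Sum>y\<in>S. w x * w y * g x y * (walk3 x y)\<^sup>2) \<le> s / d * closed4" (is "?F \<le> _")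
proof -
  have "?F = (\<Sum>x\<in>S. \<Sum>y\<in>S. \<Sum>z\<in>S. w y * g x y * a x z * ((w z * walk2 z y) * (w x * walk3 x y)))"
    unfolding power2_eq_square
    by (subst (2) walk3_def) (simp add: sum_distrib_left sum_distrib_right mult_ac)
  also have "\<dots> \<le> (\<Sum>x\<in>S. \<Sum>y\<in>S. \<Sum>z\<in>S. w y * g x y * a x z *
      (((w z * walk2 z y)\<^sup>2 + (w x * walk3 x y)\<^sup>2) / 2))"
    by (intro sum_mono mult_left_mono mult_le_mean_squares) auto
  also have "\<dots> = (\<Sum>x\<in>S. \<Sum>y\<in>S. \<Sum>z\<in>S. w y * g x y * a x z * (w z * walk2 z y)\<^sup>2) / 2 +
      (\<Sum>x\<in>S. \<Sum>y\<in>S. \<Sum>z\<in>S. w y * g x y * a x z * (w x * walk3 x y)\<^sup>2) / 2"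
    by (simp add: sum_divide_distrib add_divide_distrib distrib_left sum.distrib)
  also have "(\<Sum>x\<in>S. \<Sum>y\<in>S. \<Sum>z\<in>S. w y * g x y * a x z * (w x * walk3 x y)\<^sup>2) = ?F"
  proof (intro sum.cong refl)
    fix x y assume "x \<in> S"
    have "(\<Sum>z\<in>S. w y * g x y * a x z * (w x * walk3 x y)\<^sup>2) =
        deg x * (w y * g x y * (w x * walk3 x y)\<^sup>2)"
      unfolding deg_def sum_distrib_right by (simp add: mult_ac)
    then show "(\<Sum>z\<in>S. w y * g x y * a x z * (w x * walk3 x y)\<^sup>2) =
        w x * w y * g x y * (walk3 x y)\<^sup>2"
      using w_deg[OF \<open>x \<in> S\<close>] by (simp add: power2_eq_square mult_ac)
  qed
  also have "(\<Sum>x\<in>S. \<Sum>y\<in>S. \<Sum>z\<in>S. w y * g x y * a x z * (w z * walk2 z y)\<^sup>2) \<le> s / d * closed4"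
  proof -
    have "(\<Sum>x\<in>S. \<Sum>y\<in>S. \<Sum>z\<in>S. w y * g x y * a x z * (w z * walk2 z y)\<^sup>2) =
        (\<Sum>z\<in>S. \<Sum>y\<in>S. \<Sum>x\<in>S. w y * g x y * a x z * (w z * walk2 z y)\<^sup>2)"
      by (rule sum_reverse3)
    also have "\<dots> = (\<Sum>z\<in>S. \<Sum>y\<in>S. w y * (w z * (w z * (walk2 z y)\<^sup>2)) * (\<Sum>x\<in>S. a z x * g x y))"
      unfolding sum_distrib_left
      by (intro sum.cong refl) (simp add: power2_eq_square a_sym mult_ac)
    \<comment> \<open>For fixed \<open>z\<close> and \<open>y\<close> the conflict bound limits the
      sum over \<open>x\<close> to \<open>s\<close>, and one of the two factors \<open>w z\<close>
      gives \<open>1 / d\<close>.\<close>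
    also have "\<dots> \<le> (\<Sum>z\<in>S. \<Sum>y\<in>S. w y * (w z * (1 / d * (walk2 z y)\<^sup>2)) * s)"
      using s_pos d_pos
      by (intro sum_mono mult_mono mult_nonneg_nonneg sum_a_g sum_nonneg) (auto simp: w_le)
    also have "\<dots> = s / d * closed4"
      unfolding closed4_def sum_distrib_left by (intro sum.cong refl) simp
    finally show ?thesis .
  qed
  finally show ?thesis
    by (simp add: field_simps)
qed

text \<open>
  The two squares produced by AM-GM contribute equally by symmetry, and the row sums of
  \<open>g x z * walk2 x z\<close> are at most \<open>deg x * (s / d)\<close>.
\<close>

lemma conflict2_le:
  "(\<Sum>x\<in>S. \<Sum>y\<in>S. \<Sum>z\<in>S. w x * w y * w z * g x z * walk2 x z * walk2 z y * walk2 x y)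
     \<le> s / d * closed4" (is "?F \<le> _")
proof -
  let ?B = "\<lambda>x z. g x z * walk2 x z"
  have "?F = (\<Sum>x\<in>S. \<Sum>y\<in>S. \<Sum>z\<in>S. w y * ?B x z * ((w z * walk2 z y) * (w x * walk2 x y)))"
    by (simp add: mult_ac)
  also have "\<dots> \<le> (\<Sum>x\<in>S. \<Sum>y\<in>S. \<Sum>z\<in>S. w y * ?B x z *
      (((w z * walk2 z y)\<^sup>2 + (w x * walk2 x y)\<^sup>2) / 2))"
    by (intro sum_mono mult_left_mono mult_le_mean_squares) auto
  also have "\<dots> = (\<Sum>x\<in>S. \<Sum>y\<in>S. \<Sum>z\<in>S. w y * ?B x z * (w z * walk2 z y)\<^sup>2) / 2 +
      (\<Sum>x\<in>S. \<Sum>y\<in>S. \<Sum>z\<in>S. w y * ?B x z * (w x * walk2 x y)\<^sup>2) / 2"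
    by (simp add: sum_divide_distrib add_divide_distrib distrib_left sum.distrib)
  also have "(\<Sum>x\<in>S. \<Sum>y\<in>S. \<Sum>z\<in>S. w y * ?B x z * (w z * walk2 z y)\<^sup>2) =
      (\<Sum>z\<in>S. \<Sum>y\<in>S. \<Sum>x\<in>S. w y * ?B z x * (w z * walk2 z y)\<^sup>2)"
    by (subst sum_reverse3) (simp add: g_sym walk2_sym)
  also have "(\<Sum>x\<in>S. \<Sum>y\<in>S. \<Sum>z\<in>S. w y * ?B x z * (w x * walk2 x y)\<^sup>2) \<le> s / d * closed4"
  proof -
    have row: "(\<Sum>z\<in>S. ?B x z) \<le> deg x * (s / d)" if x: "x \<in> S" for x
    proof -
      have "(\<Sum>z\<in>S. ?B x z) = (\<Sum>t\<in>S. a x t * (w t * (\<Sum>z\<in>S. a t z * g z x)))"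
        unfolding walk2_def sum_distrib_left
        by (subst sum.swap) (intro sum.cong refl, simp add: g_sym mult_ac)
      \<comment> \<open>The middle vertex \<open>t\<close> has weight at most \<open>1 / d\<close>
        and at most \<open>s\<close> neighbours \<open>z\<close> in conflict with
        \<open>x\<close>.\<close>
      also have "\<dots> \<le> (\<Sum>t\<in>S. a x t * (1 / d * s))"
        using s_pos d_pos x
        by (intro sum_mono mult_mono mult_nonneg_nonneg sum_a_g sum_nonneg) (auto simp: w_le)
      also have "\<dots> = deg x * (s / d)"
        by (simp only: sum_distrib_right[symmetric] sum_a) simp
      finally show ?thesis .
    qed
    have "(\<Sum>x\<in>S. \<Sum>y\<in>S. \<Sum>z\<in>S. w y * ?B x z * (w x * walk2 x y)\<^sup>2) =
        (\<Sum>x\<in>S. \<Sum>y\<in>S. w y * (w x * walk2 x y)\<^sup>2 * (\<Sum>z\<in>S. ?B x z))"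
      unfolding sum_distrib_left by (intro sum.cong refl) (simp add: mult_ac)
    also have "\<dots> \<le> (\<Sum>x\<in>S. \<Sum>y\<in>S. w y * (w x * walk2 x y)\<^sup>2 * (deg x * (s / d)))"
      by (intro sum_mono mult_left_mono row) auto
    also have "\<dots> = (\<Sum>x\<in>S. \<Sum>y\<in>S. (w x * deg x) * (s / d * (w x * w y * (walk2 x y)\<^sup>2)))"
      by (simp add: power2_eq_square mult_ac)
    also have "\<dots> = s / d * closed4"
      unfolding closed4_def sum_distrib_left by (intro sum.cong refl) (simp add: w_deg)
    finally show ?thesis .
  qed
  finally show ?thesis
    by simp
qed

section \<open>Sums over closed 6-walks\<close>

definition weight :: "'a \<Rightarrow> 'a \<Rightarrow> 'a \<Rightarrow> 'a \<Rightarrow> 'a \<Rightarrow> 'a \<Rightarrow> real" where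
  "weight x0 x1 x2 x3 x4 x5 =
     w x0 * w x1 * w x2 * w x3 * w x4 * w x5 * a x0 x1 * a x1 x2 * a x2 x3 * a x3 x4 * a x4 x5 * a x5 x0"

definition hex :: "('a \<Rightarrow> 'a \<Rightarrow> 'a \<Rightarrow> 'a \<Rightarrow> 'a \<Rightarrow> 'a \<Rightarrow> real) \<Rightarrow> real" where
  "hex F = (\<Sum>x0\<in>S. \<Sum>x1\<in>S. \<Sum>x2\<in>S. \<Sum>x3\<in>S. \<Sum>x4\<in>S. \<Sum>x5\<in>S.
     weight x0 x1 x2 x3 x4 x5 * F x0 x1 x2 x3 x4 x5)"

lemma hex_rotate: "hex (\<lambda>x0 x1 x2 x3 x4 x5. F x1 x2 x3 x4 x5 x0) = hex F"
  unfolding hex_def by (subst (2) sum_rotate6) (simp add: weight_def mult_ac)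

lemma hex_add:
  "hex (\<lambda>x0 x1 x2 x3 x4 x5. F x0 x1 x2 x3 x4 x5 + G x0 x1 x2 x3 x4 x5) = hex F + hex G"
  by (simp add: hex_def distrib_left sum.distrib)

text \<open>The opposite vertices \<open>x0\<close> and \<open>x3\<close> cut a closed 6-walk into
  two walks of length 3, through \<open>x1\<close>, \<open>x2\<close> and through \<open>x4\<close>,
  \<open>x5\<close>.\<close>

lemma hex_opposite:
  "hex (\<lambda>x0 x1 x2 x3 x4 x5. h x0 x3) = (\<Sum>x\<in>S. \<Sum>y\<in>S. w x * w y * h x y * (walk3 x y)\<^sup>2)"
proof -
  have "hex (\<lambda>x0 x1 x2 x3 x4 x5. h x0 x3) = (\<Sum>x0\<in>S. \<Sum>x1\<in>S. \<Sum>x2\<in>S. \<Sum>x3\<in>S.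
      (w x0 * w x3 * h x0 x3 * walk3 x3 x0) * (a x3 x2 * w x2 * (a x2 x1 * w x1 * a x1 x0)))"
    unfolding hex_def weight_def walk3_def walk2_def sum_distrib_left sum_distrib_right
    by (intro sum.cong refl) (simp add: a_sym mult_ac)
  \<comment> \<open>The order is reversed so that the sums over \<open>x2\<close> and
    \<open>x1\<close> are nested as in \<open>walk3 x3 x0\<close>.\<close>
  also have "\<dots> = (\<Sum>x0\<in>S. \<Sum>x3\<in>S. \<Sum>x2\<in>S. \<Sum>x1\<in>S.
      (w x0 * w x3 * h x0 x3 * walk3 x3 x0) * (a x3 x2 * w x2 * (a x2 x1 * w x1 * a x1 x0)))"
    by (rule sum.cong[OF refl], rule sum_reverse3)
  also have "\<dots> = (\<Sum>x0\<in>S. \<Sum>x3\<in>S. (w x0 * w x3 * h x0 x3 * walk3 x3 x0) * walk3 x3 x0)"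
    by (simp only: walk3_def[of _ _] walk2_def sum_distrib_left[symmetric])
  finally show ?thesis
    by (simp add: walk3_sym power2_eq_square mult_ac)
qed

text \<open>The alternate vertices \<open>x0\<close>, \<open>x2\<close>, \<open>x4\<close> cut a
  closed 6-walk into three walks of length 2; they appear as \<open>x\<close>, \<open>z\<close>,
  \<open>y\<close> on the right.\<close>

lemma hex_distance2:
  "hex (\<lambda>x0 x1 x2 x3 x4 x5. h x0 x2) =
     (\<Sum>x\<in>S. \<Sum>y\<in>S. \<Sum>z\<in>S. w x * w y * w z * h x z * walk2 x z * walk2 z y * walk2 x y)"
proof -
  have "hex (\<lambda>x0 x1 x2 x3 x4 x5. h x0 x2) = (\<Sum>x0\<in>S. \<Sum>x1\<in>S. \<Sum>x2\<in>S. \<Sum>x3\<in>S. \<Sum>x4\<in>S.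
      (w x0 * w x2 * w x4 * h x0 x2 * walk2 x0 x4) * (a x0 x1 * w x1 * a x1 x2) * (a x2 x3 * w x3 * a x3 x4))"
    unfolding hex_def weight_def walk2_def sum_distrib_left sum_distrib_right
    by (intro sum.cong refl) (simp add: a_sym mult_ac)
  also have "\<dots> = (\<Sum>x0\<in>S. \<Sum>x1\<in>S. \<Sum>x2\<in>S. \<Sum>x4\<in>S. \<Sum>x3\<in>S.
      (w x0 * w x2 * w x4 * h x0 x2 * walk2 x0 x4) * (a x0 x1 * w x1 * a x1 x2) * (a x2 x3 * w x3 * a x3 x4))"
    by (rule sum.cong[OF refl], rule sum.cong[OF refl], rule sum.cong[OF refl], rule sum.swap)
  also have "\<dots> = (\<Sum>x0\<in>S. \<Sum>x1\<in>S. \<Sum>x2\<in>S. \<Sum>x4\<in>S.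
      (w x0 * w x2 * w x4 * h x0 x2 * walk2 x0 x4 * walk2 x2 x4) * (a x0 x1 * w x1 * a x1 x2))"
    unfolding walk2_def[of _ _] sum_distrib_left sum_distrib_right
    by (intro sum.cong refl) (simp add: mult_ac)
  also have "\<dots> = (\<Sum>x0\<in>S. \<Sum>x4\<in>S. \<Sum>x2\<in>S. \<Sum>x1\<in>S.
      (w x0 * w x2 * w x4 * h x0 x2 * walk2 x0 x4 * walk2 x2 x4) * (a x0 x1 * w x1 * a x1 x2))"
    by (rule sum.cong[OF refl], rule sum_reverse3)
  also have "\<dots> = (\<Sum>x0\<in>S. \<Sum>x4\<in>S. \<Sum>x2\<in>S.
      (w x0 * w x2 * w x4 * h x0 x2 * walk2 x0 x4 * walk2 x2 x4) * walk2 x0 x2)"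
    by (simp only: walk2_def sum_distrib_left[symmetric])
  finally show ?thesis
    by (simp add: mult_ac)
qed

lemma closed6_hex: "closed6 = hex (\<lambda>x0 x1 x2 x3 x4 x5. 1)"
  using hex_opposite[of "\<lambda>x y. 1"] by (simp add: closed6_def)

text \<open>Without such a hexagon, both ratios \<open>closed6 / closed4\<close> and
  \<open>closed4 / closed2\<close> are at most \<open>9 * s / d\<close>, one \<open>s / d\<close>
  for each kind of conflict. With \<open>1 \<le> closed6\<close> and
  \<open>closed2 \<le> card S / d\<close> this bounds \<open>d ^ 3\<close> by
  \<open>81 * s\<^sup>2 * card S\<close>.\<close>

lemma conflict_free_hexagon:
  assumes dense: "81 * s\<^sup>2 * card S < d ^ 3"
  obtains x0 x1 x2 x3 x4 x5 where
    "x0 \<in> S" "x1 \<in> S" "x2 \<in> S" "x3 \<in> S" "x4 \<in> S" "x5 \<in> S"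
    "adj x0 x1" "adj x1 x2" "adj x2 x3" "adj x3 x4" "adj x4 x5" "adj x5 x0"
    "\<not> sim x0 x2" "\<not> sim x1 x3" "\<not> sim x2 x4" "\<not> sim x3 x5" "\<not> sim x4 x0" "\<not> sim x5 x1"
    "\<not> sim x0 x3" "\<not> sim x1 x4" "\<not> sim x2 x5"
proof (rule ccontr)
  assume no_hexagon: "\<not> thesis"
  note hexagon = that
  \<comment> \<open>A closed walk of nonzero weight has a conflict, so the nine conflict indicators
    sum to at least 1 on it.\<close>
  have pointwise: "weight x0 x1 x2 x3 x4 x5 * 1 \<le> weight x0 x1 x2 x3 x4 x5 *
      (g x0 x2 + (g x1 x3 + (g x2 x4 + (g x3 x5 + (g x4 x0 + (g x5 x1 + (g x0 x3 + (g x1 x4 + g x2 x5))))))))"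
    if "x0 \<in> S" "x1 \<in> S" "x2 \<in> S" "x3 \<in> S" "x4 \<in> S" "x5 \<in> S" for x0 x1 x2 x3 x4 x5
  proof (cases "weight x0 x1 x2 x3 x4 x5 = 0")
    case False
    then have adj: "adj x0 x1" "adj x1 x2" "adj x2 x3" "adj x3 x4" "adj x4 x5" "adj x5 x0"
      by (auto simp: weight_def a_def split: if_splits)
    have "0 \<le> weight x0 x1 x2 x3 x4 x5"
      by (simp add: weight_def)
    moreover have "1 \<le> g x0 x2 + (g x1 x3 + (g x2 x4 + (g x3 x5 + (g x4 x0 + (g x5 x1 +
        (g x0 x3 + (g x1 x4 + g x2 x5)))))))"
    proof (rule ccontr)
      assume "\<not> ?thesis"
      then have "\<not> sim x0 x2" "\<not> sim x1 x3" "\<not> sim x2 x4" "\<not> sim x3 x5" "\<not> sim x4 x0" "\<not> sim x5 x1"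
        "\<not> sim x0 x3" "\<not> sim x1 x4" "\<not> sim x2 x5"
        unfolding not_sim_iff
        using g_nonneg[of x0 x2] g_nonneg[of x1 x3] g_nonneg[of x2 x4] g_nonneg[of x3 x5] g_nonneg[of x4 x0]
          g_nonneg[of x5 x1] g_nonneg[of x0 x3] g_nonneg[of x1 x4] g_nonneg[of x2 x5]
        by linarith+
      from hexagon[OF that adj this] no_hexagon show False
        by contradiction
    qed
    ultimately show ?thesis
      by (rule mult_left_mono[rotated])
  qed simp
  define e where "e = s / d"
  have e: "e > 0"
    using s_pos d_pos by (simp add: e_def)
  let ?D2 = "hex (\<lambda>x0 x1 x2 x3 x4 x5. g x0 x2)" and ?D3 = "hex (\<lambda>x0 x1 x2 x3 x4 x5. g x0 x3)"
  have "closed6 \<le> hex (\<lambda>x0 x1 x2 x3 x4 x5. g x0 x2 + (g x1 x3 + (g x2 x4 + (g x3 x5 +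
      (g x4 x0 + (g x5 x1 + (g x0 x3 + (g x1 x4 + g x2 x5))))))))"
    unfolding closed6_hex hex_def by (intro sum_mono pointwise)
  \<comment> \<open>Rotating the walk identifies the six conflicts at distance 2 with each other,
    and likewise the three opposite ones.\<close>
  also have "\<dots> = 6 * ?D2 + 3 * ?D3"
    unfolding hex_add
    using hex_rotate[of "\<lambda>x0 x1 x2 x3 x4 x5. g x0 x2"] hex_rotate[of "\<lambda>x0 x1 x2 x3 x4 x5. g x1 x3"]
      hex_rotate[of "\<lambda>x0 x1 x2 x3 x4 x5. g x2 x4"] hex_rotate[of "\<lambda>x0 x1 x2 x3 x4 x5. g x3 x5"]
      hex_rotate[of "\<lambda>x0 x1 x2 x3 x4 x5. g x4 x0"]
      hex_rotate[of "\<lambda>x0 x1 x2 x3 x4 x5. g x0 x3"] hex_rotate[of "\<lambda>x0 x1 x2 x3 x4 x5. g x1 x4"]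
    by linarith
  also have "\<dots> \<le> 6 * (e * closed4) + 3 * (e * closed4)"
    unfolding hex_opposite hex_distance2 e_def
    by (intro add_mono mult_left_mono conflict2_le conflict3_le) auto
  also have "\<dots> = 9 * e * closed4"
    by simp
  finally have c6: "closed6 \<le> 9 * e * closed4" .
  \<comment> \<open>With \<open>t = 9 * e\<close> the bound \<open>c6\<close> turns the last term
    into \<open>closed4\<close>, which cancels one of the two copies on the left.\<close>
  have "2 * closed4 \<le> 9 * e * closed2 + closed6 / (9 * e)"
    using e by (intro closed4_le) simp
  also have "closed6 / (9 * e) \<le> closed4"
    using c6 e by (simp add: field_simps)
  finally have c4: "closed4 \<le> 9 * e * closed2"
    by simp
  have "1 \<le> closed6"
    by (rule closed6_ge_1)
  also have "\<dots> \<le> 9 * e * (9 * e * (card S / d))"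
    using e by (intro order.trans[OF c6] mult_left_mono order.trans[OF c4] closed2_le) auto
  also have "\<dots> = 81 * s\<^sup>2 * card S / d ^ 3"
    by (simp add: e_def power2_eq_square power3_eq_cube)
  finally show False
    using dense d_pos by (simp add: field_simps)
qed

end

section \<open>A subgraph whose minimum degree is half the average degree\<close>

lemma min_degree_subgraph:
  fixes V :: "'a set" and adj :: "'a \<Rightarrow> 'a \<Rightarrow> bool"
  assumes "finite V" "V \<noteq> {}" and sym: "\<And>x y. adj x y \<Longrightarrow> adj y x" and irrefl: "\<And>x. \<not> adj x x"
  defines "k \<equiv> (\<Sum>x\<in>V. real (card {y\<in>V. adj x y})) / (2 * card V)"
  shows "\<exists>S\<subseteq>V. S \<noteq> {} \<and> (\<forall>x\<in>S. k \<le> card {y\<in>S. adj x y})"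
proof -
  \<comment> \<open>As \<open>2 * k\<close> is the average degree, \<open>f V = 0\<close>. In a
    nonempty maximiser of \<open>f\<close> every degree is at least \<open>k\<close>, since deleting
    a vertex of smaller degree would increase \<open>f\<close>.\<close>
  define f where "f S = (\<Sum>x\<in>S. real (card {y\<in>S. adj x y})) - 2 * k * card S" for S
  define \<S> where "\<S> = {S. S \<subseteq> V \<and> S \<noteq> {}}"
  have "finite \<S>" "\<S> \<noteq> {}"
    using assms(1,2) by (auto simp: \<S>_def)
  then obtain S where S: "S \<in> \<S>" "Max (f ` \<S>) = f S"
    by (rule obtains_MAX)
  then have max: "f T \<le> f S" if "T \<in> \<S>" for T
    using Max_ge[of "f ` \<S>" "f T"] \<open>finite \<S>\<close> that by simp
  then have S': "S \<subseteq> V" "S \<noteq> {}" "finite S"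
    using S(1) finite_subset[OF _ assms(1)] unfolding \<S>_def by simp_all
  have "f V = 0"
    using assms(1,2) by (simp add: f_def k_def)
  then have "f S \<ge> 0"
    using max[of V] assms(2) by (simp add: \<S>_def)
  have "k \<le> card {y\<in>S. adj x y}" if x: "x \<in> S" for x
  proof (rule ccontr)
    assume less: "\<not> k \<le> card {y\<in>S. adj x y}"
    let ?T = "S - {x}"
    have T: "finite ?T" "S = insert x ?T" "x \<notin> ?T"
      using S' x by auto
    have "card {z\<in>S. adj y z} = card {z\<in>?T. adj y z} + of_bool (adj x y)" if "y \<in> ?T" for y
    proof (cases "adj x y")
      case True
      then have "{z\<in>S. adj y z} = insert x {z\<in>?T. adj y z}"
        using x sym[OF True] by auto
      then show ?thesis
        using True T(1) by simp
    next
      case False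
      then have "{z\<in>S. adj y z} = {z\<in>?T. adj y z}"
        using sym by blast
      then show ?thesis
        using False by simp
    qed
    then have "(\<Sum>y\<in>?T. real (card {z\<in>S. adj y z})) =
        (\<Sum>y\<in>?T. real (card {z\<in>?T. adj y z})) + (\<Sum>y\<in>?T. of_bool (adj x y))"
      unfolding sum.distrib[symmetric] by (intro sum.cong refl) simp
    also have "(\<Sum>y\<in>?T. of_bool (adj x y)) = real (card {y\<in>?T. adj x y})"
      using T(1) by (simp add: of_bool_def sum.If_cases Int_def)
    also have "{y\<in>?T. adj x y} = {y\<in>S. adj x y}"
      using irrefl by auto
    \<comment> \<open>Deleting \<open>x\<close> costs its degree twice: its own term, and one at
      each neighbour.\<close>
    finally have *: "(\<Sum>y\<in>S. real (card {z\<in>S. adj y z})) =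
        (\<Sum>y\<in>?T. real (card {z\<in>?T. adj y z})) + 2 * card {y\<in>S. adj x y}"
      using sum.remove[OF S'(3) x, of "\<lambda>y. real (card {z\<in>S. adj y z})"] by simp
    have "card S = card ?T + 1"
      using card.remove[OF S'(3) x] by simp
    with * less have "f ?T > f S"
      by (simp add: f_def algebra_simps)
    \<comment> \<open>The maximum ranges over nonempty sets only, so \<open>?T\<close> must be seen
      to be one; the empty set has value 0, below \<open>f ?T\<close>.\<close>
    moreover have "f ?T = 0" if "?T = {}"
      unfolding that by (simp add: f_def)
    then have "?T \<noteq> {}"
      using \<open>f ?T > f S\<close> \<open>f S \<ge> 0\<close> by fastforce
    ultimately show False
      using max[of ?T] S' by (auto simp: \<S>_def)
  qed
  then show ?thesis
    using S' by (intro exI[of _ S]) simp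
qed

section \<open>Copies of graphs in coloured complete graphs\<close>

definition map_graph :: "('a \<Rightarrow> 'b) \<Rightarrow> 'a ugraph \<Rightarrow> 'b ugraph" where
  "map_graph \<phi> H = \<lparr>verts = \<phi> ` verts H, edges = (`) \<phi> ` edges H\<rparr>"

lemma verts_map_graph [simp]: "verts (map_graph \<phi> H) = \<phi> ` verts H"
  and edges_map_graph [simp]: "edges (map_graph \<phi> H) = (`) \<phi> ` edges H"
  by (simp_all add: map_graph_def)

lemma edge_map_graph_iff:
  assumes "simple_graph H" "inj_on \<phi> (verts H)" "u \<in> verts H" "v \<in> verts H"
  shows "{\<phi> u, \<phi> v} \<in> edges (map_graph \<phi> H) \<longleftrightarrow> {u, v} \<in> edges H"
proof
  assume "{\<phi> u, \<phi> v} \<in> edges (map_graph \<phi> H)"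
  then obtain e where e: "e \<in> edges H" "\<phi> ` {u, v} = \<phi> ` e"
    by auto
  then have "e \<subseteq> verts H"
    using assms(1) by (auto simp: simple_graph_def)
  then have "{u, v} = e"
    using inj_on_image_eq_iff[OF assms(2), of "{u, v}" e] e(2) assms(3,4) by simp
  then show "{u, v} \<in> edges H"
    using e(1) by simp
next
  assume "{u, v} \<in> edges H"
  then have "\<phi> ` {u, v} \<in> edges (map_graph \<phi> H)"
    unfolding edges_map_graph by (rule imageI)
  then show "{\<phi> u, \<phi> v} \<in> edges (map_graph \<phi> H)"
    by simp
qed

lemma is_copy_map_graph:
  assumes "simple_graph H" "inj_on \<phi> (verts H)" "\<phi> ` verts H \<subseteq> {..<n}"
  shows "is_copy H (map_graph \<phi> H) (complete_graph n)"
proof -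
  have edge: "\<phi> ` e \<subseteq> \<phi> ` verts H \<and> card (\<phi> ` e) = 2" if "e \<in> edges H" for e
    using assms(1,2) that card_image[OF inj_on_subset[OF assms(2)], of e]
    by (auto simp: simple_graph_def)
  have "graph_iso \<phi> H (map_graph \<phi> H)"
    using assms(2) edge_map_graph_iff[OF assms(1,2)]
    by (simp add: graph_iso_def bij_betw_def del: edges_map_graph)
  moreover have "simple_graph (map_graph \<phi> H)"
    using edge by (simp add: simple_graph_def)
  moreover have "edges (map_graph \<phi> H) \<subseteq> edges (complete_graph n)"
    using edge assms(3) by (fastforce simp: complete_graph_def)
  ultimately show ?thesis
    using assms(3) by (auto simp: is_copy_def complete_graph_def)
qed

text \<open>Reduces a 2-repeat to two embeddings with disjoint images and equal edge colours; the
  colour isomorphism is \<open>\<psi>\<close> after the inverse of \<open>\<phi>\<close>.\<close>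

lemma two_repeat_of_maps:
  assumes H: "simple_graph H" and \<phi>: "inj_on \<phi> (verts H)" and \<psi>: "inj_on \<psi> (verts H)"
    and "\<phi> ` verts H \<subseteq> {..<n}" "\<psi> ` verts H \<subseteq> {..<n}" "\<phi> ` verts H \<inter> \<psi> ` verts H = {}"
    and col: "\<And>e. e \<in> edges H \<Longrightarrow> c (\<psi> ` e) = c (\<phi> ` e)"
  shows "has_two_repeat (complete_graph n) c H"
proof -
  define \<chi> where "\<chi> = \<psi> \<circ> inv_into (verts H) \<phi>"
  have \<chi>: "\<chi> (\<phi> u) = \<psi> u" if "u \<in> verts H" for u
    using \<phi> that by (simp add: \<chi>_def)
  have "bij_betw \<chi> (\<phi> ` verts H) (\<psi> ` verts H)"
    unfolding \<chi>_def using \<phi> \<psi>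
    by (intro bij_betw_trans[OF bij_betw_inv_into]) (auto intro: inj_on_imp_bij_betw)
  then have "graph_iso \<chi> (map_graph \<phi> H) (map_graph \<psi> H)"
    using edge_map_graph_iff[OF H \<phi>] edge_map_graph_iff[OF H \<psi>]
    by (auto simp: graph_iso_def \<chi> simp del: edges_map_graph)
  moreover have "c (\<chi> ` e) = c e" if e: "e \<in> edges (map_graph \<phi> H)" for e
  proof -
    obtain f where f: "f \<in> edges H" "e = \<phi> ` f"
      using e by auto
    moreover have "\<chi> ` \<phi> ` f = \<psi> ` f"
      unfolding image_image using f(1) H \<chi> by (intro image_cong) (auto simp: simple_graph_def)
    ultimately show ?thesis
      using col by simp
  qed
  ultimately show ?thesis
    unfolding has_two_repeat_def colour_isomorphic_def
    using is_copy_map_graph[OF H \<phi>] is_copy_map_graph[OF H \<psi>] assms(4-6)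
    by (metis verts_map_graph)
qed

lemma simple_cycle_graph_6: "simple_graph (cycle_graph 6)"
proof -
  have "i \<noteq> Suc i mod 6" if "i < 6" for i :: nat
    using that by presburger
  then show ?thesis
    by (auto simp: simple_graph_def cycle_graph_def)
qed

text \<open>\<open>LEAST\<close> is attained once some colouring is admissible. Distinct colours on
  all edges work: a colour isomorphism would map each edge to itself, so copies with an edge could
  not be disjoint.\<close>

lemma f2_attained:
  assumes "simple_graph H" "edges H \<noteq> {}"
  obtains c :: "nat set \<Rightarrow> nat" where "proper_colouring (complete_graph n) c"
    "card (c ` edges (complete_graph n)) = f2 n H" "\<not> has_two_repeat (complete_graph n) c H"
proof -
  let ?E = "edges (complete_graph n)"
  have "finite ?E"
    by (simp add: complete_graph_def)
  then obtain c :: "nat set \<Rightarrow> nat" where c: "inj_on c ?E"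
    using finite_imp_inj_to_nat_seg by metis
  have "\<not> has_two_repeat (complete_graph n) c H"
  proof
    assume "has_two_repeat (complete_graph n) c H"
    then obtain A B \<phi> \<theta> where A: "simple_graph A" "edges A \<subseteq> ?E" "graph_iso \<theta> H A"
      and B: "edges B \<subseteq> ?E" and disj: "verts A \<inter> verts B = {}"
      and \<phi>: "graph_iso \<phi> A B" "\<forall>e\<in>edges A. c (\<phi> ` e) = c e"
      unfolding has_two_repeat_def is_copy_def colour_isomorphic_def by blast
    obtain e where e: "e \<in> edges H"
      using assms(2) by blast
    then have "e \<subseteq> verts H" "card e = 2"
      using assms(1) by (auto simp: simple_graph_def)
    then obtain u v where "e = {u, v}" "u \<in> verts H" "v \<in> verts H"
      by (auto simp: card_2_iff)
    then have uv: "{\<theta> u, \<theta> v} \<in> edges A" "\<theta> u \<in> verts A" "\<theta> v \<in> verts A"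
      using A(3) e by (auto simp: graph_iso_def bij_betw_def)
    then have "{\<phi> (\<theta> u), \<phi> (\<theta> v)} \<in> edges B" "\<phi> (\<theta> u) \<in> verts B"
      using \<phi>(1) by (auto simp: graph_iso_def bij_betw_def)
    moreover have "c {\<phi> (\<theta> u), \<phi> (\<theta> v)} = c {\<theta> u, \<theta> v}"
      using \<phi>(2) uv(1) by fastforce
    ultimately have "{\<phi> (\<theta> u), \<phi> (\<theta> v)} = {\<theta> u, \<theta> v}"
      using c A(2) B uv(1) by (meson inj_onD subsetD)
    then have "\<phi> (\<theta> u) \<in> verts A"
      using uv(2,3) by (auto simp: doubleton_eq_iff)
    then show False
      using disj \<open>\<phi> (\<theta> u) \<in> verts B\<close> by blast
  qed
  moreover have "proper_colouring (complete_graph n) c"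
    using c by (auto simp: proper_colouring_def inj_on_def)
  ultimately have "\<exists>C. \<exists>c :: nat set \<Rightarrow> nat. proper_colouring (complete_graph n) c \<and>
      card (c ` ?E) = C \<and> \<not> has_two_repeat (complete_graph n) c H"
    by blast
  from LeastI_ex[OF this] show ?thesis
    using that unfolding f2_def by blast
qed

section \<open>The auxiliary graph on ordered pairs\<close>

text \<open>These pairs play two roles: they are the vertices of the auxiliary graph, and in
  \<open>parallel_count\<close> also the oriented edges of the complete graph.\<close>

definition arcs :: "nat \<Rightarrow> (nat \<times> nat) set" where
  "arcs n = (SIGMA u:{..<n}. {..<n} - {u})"

lemma mem_arcs_iff: "(u, v) \<in> arcs n \<longleftrightarrow> u < n \<and> v < n \<and> u \<noteq> v"
  by (auto simp: arcs_def)

lemma finite_arcs [simp]: "finite (arcs n)"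
  by (simp add: arcs_def)

lemma card_arcs: "card (arcs n) = n * (n - 1)"
proof -
  have "card (arcs n) = (\<Sum>u<n. card ({..<n} - {u}))"
    by (simp add: arcs_def)
  also have "\<dots> = (\<Sum>u<n. n - 1)"
    by (intro sum.cong refl) simp
  finally show ?thesis
    by simp
qed

text \<open>
  \<open>parallel c (u, v) (u', v')\<close> is adjacency in the auxiliary graph: following a walk in it, the first
  and the second components trace two walks with the same colours.
\<close>

definition parallel :: "(nat set \<Rightarrow> 'c) \<Rightarrow> nat \<times> nat \<Rightarrow> nat \<times> nat \<Rightarrow> bool" where
  "parallel c x y \<longleftrightarrow> distinct [fst x, snd x, fst y, snd y] \<and> c {fst x, fst y} = c {snd x, snd y}"

definition touching :: "nat \<times> nat \<Rightarrow> nat \<times> nat \<Rightarrow> bool" where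
  "touching x y \<longleftrightarrow> {fst x, snd x} \<inter> {fst y, snd y} \<noteq> {}"

lemma proper_colouring_disjoint:
  assumes "proper_colouring G c" "e \<in> edges G" "e' \<in> edges G" "c e = c e'" "e \<noteq> e'"
  shows "e \<inter> e' = {}"
  using assms unfolding proper_colouring_def by blast

lemma proper_colouringD:
  assumes "proper_colouring (complete_graph n) c" "u < n" "v < n" "w < n" "u \<noteq> v" "u \<noteq> w"
    "c {u, v} = c {u, w}"
  shows "v = w"
proof (rule ccontr)
  assume "v \<noteq> w"
  then have "{u, v} \<noteq> {u, w}"
    by (simp add: doubleton_eq_iff)
  moreover have "{u, v} \<in> edges (complete_graph n)" "{u, w} \<in> edges (complete_graph n)"
    using assms(2-6) by (simp_all add: complete_graph_def)
  ultimately have "{u, v} \<inter> {u, w} = {}"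
    using proper_colouring_disjoint[OF assms(1)] assms(7) by metis
  then show False
    by simp
qed

text \<open>Given \<open>x\<close>, either component of a parallel \<open>z\<close> determines the
  other: it fixes the common colour, and by properness that colour occurs at most once at the other
  component of \<open>x\<close>. Touching \<open>y\<close> means that one of two components of
  \<open>z\<close> equals one of two entries of \<open>y\<close>, which leaves 4 cases.\<close>

lemma few_touching:
  assumes proper: "proper_colouring (complete_graph n) c" and S: "S \<subseteq> arcs n" and x: "x \<in> S"
  shows "card {z\<in>S. parallel c x z \<and> touching z y} \<le> 4"
proof -
  define L where "L t = {z\<in>S. parallel c x z \<and> fst z = t}" for t
  define R where "R t = {z\<in>S. parallel c x z \<and> snd z = t}" for t
  have fin: "finite S"
    using S finite_arcs by (rule finite_subset)
  have arc: "fst z < n" "snd z < n" if "z \<in> S" for z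
    using that S mem_arcs_iff[of "fst z" "snd z" n] by auto
  have L: "card (L t) \<le> 1" for t
    unfolding One_nat_def L_def
  proof (subst card_le_Suc0_iff_eq, use fin in simp, intro ballI)
    fix z z' assume "z \<in> {z\<in>S. parallel c x z \<and> fst z = t}" "z' \<in> {z\<in>S. parallel c x z \<and> fst z = t}"
    then have z: "z \<in> S" "z' \<in> S" "parallel c x z" "parallel c x z'" "fst z = fst z'"
      by simp_all
    then have "c {snd x, snd z} = c {snd x, snd z'}"
      unfolding parallel_def by metis
    then have "snd z = snd z'"
      using z arc x by (intro proper_colouringD[OF proper, of "snd x"]) (simp_all add: parallel_def)
    then show "z = z'"
      using z(5) by (simp add: prod_eq_iff)
  qed
  have R: "card (R t) \<le> 1" for t
    unfolding One_nat_def R_def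
  proof (subst card_le_Suc0_iff_eq, use fin in simp, intro ballI)
    fix z z' assume "z \<in> {z\<in>S. parallel c x z \<and> snd z = t}" "z' \<in> {z\<in>S. parallel c x z \<and> snd z = t}"
    then have z: "z \<in> S" "z' \<in> S" "parallel c x z" "parallel c x z'" "snd z = snd z'"
      by simp_all
    then have "c {fst x, fst z} = c {fst x, fst z'}"
      unfolding parallel_def by metis
    then have "fst z = fst z'"
      using z arc x by (intro proper_colouringD[OF proper, of "fst x"]) (simp_all add: parallel_def)
    then show "z = z'"
      using z(5) by (simp add: prod_eq_iff)
  qed
  have "finite (L t)" "finite (R t)" for t
    using fin by (simp_all add: L_def R_def)
  moreover have "{z\<in>S. parallel c x z \<and> touching z y} \<subseteq>
      (L (fst y) \<union> L (snd y)) \<union> (R (fst y) \<union> R (snd y))"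
    by (auto simp: L_def R_def touching_def)
  ultimately have "card {z\<in>S. parallel c x z \<and> touching z y} \<le>
      card ((L (fst y) \<union> L (snd y)) \<union> (R (fst y) \<union> R (snd y)))"
    by (intro card_mono) auto
  also have "\<dots> \<le> (card (L (fst y)) + card (L (snd y))) + (card (R (fst y)) + card (R (snd y)))"
    by (intro order.trans[OF card_Un_le] add_mono order_refl)
  also have "\<dots> \<le> 4"
    using L[of "fst y"] L[of "snd y"] R[of "fst y"] R[of "snd y"] by linarith
  finally show ?thesis .
qed

section \<open>Counting parallel pairs through the colour classes\<close>

lemma card_monochromatic_pairs_ge:
  assumes "finite P"
  shows "(real (card P))\<^sup>2 \<le> card (f ` P) * real (card {(p, q). p \<in> P \<and> q \<in> P \<and> f p = f q})"
proof -
  define m where "m k = card {p\<in>P. f p = k}" for k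
  define C where "C = real (card (f ` P))"
  have P: "(\<Sum>k\<in>f ` P. real (m k)) = card P"
    unfolding m_def using card_eq_sum[of P] sum.image_gen[OF assms, of "\<lambda>_. 1::nat" f]
    by (simp flip: of_nat_sum)
  have "{(p, q). p \<in> P \<and> q \<in> P \<and> f p = f q} = (SIGMA p:P. {q\<in>P. f q = f p})"
    by auto
  then have "real (card {(p, q). p \<in> P \<and> q \<in> P \<and> f p = f q}) = (\<Sum>p\<in>P. real (m (f p)))"
    using assms by (simp add: m_def)
  also have "\<dots> = (\<Sum>k\<in>f ` P. \<Sum>p\<in>{p\<in>P. f p = k}. real (m (f p)))"
    by (rule sum.image_gen[OF assms])
  also have "\<dots> = (\<Sum>k\<in>f ` P. (real (m k))\<^sup>2)"
    by (intro sum.cong refl) (simp add: m_def power2_eq_square)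
  finally have Q: "real (card {(p, q). p \<in> P \<and> q \<in> P \<and> f p = f q}) = (\<Sum>k\<in>f ` P. (real (m k))\<^sup>2)" .
  \<comment> \<open>Cauchy-Schwarz over the classes: their sizes sum to \<open>card P\<close> and
    the squares of the sizes to the number of monochromatic pairs.\<close>
  show ?thesis
    unfolding Q P[symmetric] using sum_squared_le_sum_of_squares[of "\<lambda>k. real (m k)" "f ` P"] assms
    by (simp add: mult.commute)
qed

text \<open>Two oriented edges of one colour become a parallel pair by matching their tails and
  their heads. The exceptions are an oriented edge with itself or with its reverse, hence the term
  \<open>2 * card (arcs n)\<close>.\<close>

lemma parallel_count:
  assumes proper: "proper_colouring (complete_graph n) c"
  defines "C \<equiv> card (c ` edges (complete_graph n))"
  shows "(real (card (arcs n)))\<^sup>2 \<le>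
    C * ((\<Sum>x\<in>arcs n. real (card {y\<in>arcs n. parallel c x y})) + 2 * card (arcs n))"
proof -
  let ?P = "arcs n"
  define f where "f p = c {fst p, snd p}" for p :: "nat \<times> nat"
  define Q where "Q = {(p, q). p \<in> ?P \<and> q \<in> ?P \<and> f p = f q}"
  define R where "R = (SIGMA x:?P. {y\<in>?P. parallel c x y})"
  have R: "real (card R) = (\<Sum>x\<in>?P. real (card {y\<in>?P. parallel c x y}))"
    by (simp add: R_def)
  have "Q \<subseteq> (\<lambda>(x, y). ((fst x, fst y), (snd x, snd y))) ` R \<union> ((\<lambda>p. (p, p)) ` ?P \<union> (\<lambda>p. (p, prod.swap p)) ` ?P)"
  proof (rule subsetI)
    fix z assume "z \<in> Q"
    obtain u u' v v' where z: "z = ((u, u'), (v, v'))"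
      by (cases z, cases "fst z", cases "snd z") simp
    have uv: "(u, u') \<in> ?P" "(v, v') \<in> ?P" "c {u, u'} = c {v, v'}"
      using \<open>z \<in> Q\<close> by (simp_all add: z Q_def f_def)
    show "z \<in> (\<lambda>(x, y). ((fst x, fst y), (snd x, snd y))) ` R \<union> ((\<lambda>p. (p, p)) ` ?P \<union> (\<lambda>p. (p, prod.swap p)) ` ?P)"
    proof (cases "{u, u'} = {v, v'}")
      case True
      then have "z = ((u, u'), (u, u')) \<or> z = ((u, u'), prod.swap (u, u'))"
        unfolding z doubleton_eq_iff by auto
      then show ?thesis
        using uv(1) by blast
    next
      \<comment> \<open>Distinct edges of one colour are disjoint by properness, which gives the
        four distinct vertices in \<open>parallel\<close>.\<close>
      case False
      moreover have "{u, u'} \<in> edges (complete_graph n)" "{v, v'} \<in> edges (complete_graph n)"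
        using uv by (auto simp: complete_graph_def mem_arcs_iff)
      ultimately have "{u, u'} \<inter> {v, v'} = {}"
        using proper_colouring_disjoint[OF proper] uv(3) by metis
      then have "((u, v), (u', v')) \<in> R"
        using uv by (auto simp: R_def parallel_def mem_arcs_iff)
      then show ?thesis
        unfolding z by (intro UnI1 image_eqI[where x = "((u, v), (u', v'))"]) simp_all
    qed
  qed
  moreover have "finite R"
    by (simp add: R_def)
  ultimately have "card Q \<le> card ((\<lambda>(x, y). ((fst x, fst y), (snd x, snd y))) ` R \<union>
      ((\<lambda>p. (p, p)) ` ?P \<union> (\<lambda>p. (p, prod.swap p)) ` ?P))"
    by (intro card_mono) auto
  also have "\<dots> \<le> card R + (card ?P + card ?P)"
    by (intro order.trans[OF card_Un_le] add_mono card_image_le order.trans[OF card_Un_le]) (auto simp: R_def)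
  finally have Q: "real (card Q) \<le> real (card R) + 2 * card ?P"
    by linarith
  have "f ` ?P \<subseteq> c ` edges (complete_graph n)"
    by (auto simp: f_def complete_graph_def mem_arcs_iff)
  then have fC: "card (f ` ?P) \<le> C"
    unfolding C_def by (intro card_mono) (auto simp: complete_graph_def)
  have "(real (card ?P))\<^sup>2 \<le> card (f ` ?P) * real (card Q)"
    unfolding Q_def by (rule card_monochromatic_pairs_ge) simp
  also have "\<dots> \<le> C * (real (card R) + 2 * card ?P)"
    using fC Q by (intro mult_mono) auto
  finally show ?thesis
    unfolding R .
qed

section \<open>From hexagons of disjoint pairs to the bound on colours\<close>

lemma hexagon_two_repeat:
  assumes x: "\<And>i. i < 6 \<Longrightarrow> x i \<in> arcs n"
    and par: "\<And>i. i < 6 \<Longrightarrow> parallel c (x i) (x (Suc i mod 6))"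
    and sep: "\<And>i j. i < 6 \<Longrightarrow> j < 6 \<Longrightarrow> i \<noteq> j \<Longrightarrow> \<not> touching (x i) (x j)"
  shows "has_two_repeat (complete_graph n) c (cycle_graph 6)"
proof (rule two_repeat_of_maps[where \<phi> = "fst \<circ> x" and \<psi> = "snd \<circ> x"])
  have arc: "fst (x i) < n" "snd (x i) < n" "fst (x i) \<noteq> snd (x i)" if "i < 6" for i
    using x[OF that] mem_arcs_iff[of "fst (x i)" "snd (x i)" n] by auto
  show "simple_graph (cycle_graph 6)"
    by (rule simple_cycle_graph_6)
  show "inj_on (fst \<circ> x) (verts (cycle_graph 6))" "inj_on (snd \<circ> x) (verts (cycle_graph 6))"
    using sep by (auto simp: inj_on_def cycle_graph_def touching_def)
  show "(fst \<circ> x) ` verts (cycle_graph 6) \<subseteq> {..<n}" "(snd \<circ> x) ` verts (cycle_graph 6) \<subseteq> {..<n}"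
    using arc by (auto simp: cycle_graph_def)
  \<comment> \<open>For \<open>i = j\<close> this holds because \<open>x i\<close> is an arc,
    otherwise because the pairs are disjoint.\<close>
  have "fst (x i) \<noteq> snd (x j)" if "i < 6" "j < 6" for i j
    using sep[OF that] arc[OF that(1)] by (cases "i = j") (auto simp: touching_def)
  then show "(fst \<circ> x) ` verts (cycle_graph 6) \<inter> (snd \<circ> x) ` verts (cycle_graph 6) = {}"
    by (fastforce simp: cycle_graph_def)
  show "c ((snd \<circ> x) ` e) = c ((fst \<circ> x) ` e)" if "e \<in> edges (cycle_graph 6)" for e
    using that par by (auto simp: cycle_graph_def parallel_def)
qed

text \<open>Here \<open>k\<close> is half the average degree of the auxiliary graph, and
  \<open>1296 = 81 * 4\<^sup>2\<close> comes from the conflict bound 4.\<close>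

lemma two_repeat_of_many_parallel:
  fixes k :: real
  assumes proper: "proper_colouring (complete_graph n) c" and n: "n \<ge> 2"
  defines "k \<equiv> (\<Sum>x\<in>arcs n. real (card {y\<in>arcs n. parallel c x y})) / (2 * card (arcs n))"
  assumes dense: "1296 * card (arcs n) < k ^ 3"
  shows "has_two_repeat (complete_graph n) c (cycle_graph 6)"
proof -
  have "(0, 1) \<in> arcs n"
    using n by (simp add: mem_arcs_iff)
  then have "arcs n \<noteq> {}"
    by blast
  have par_sym: "parallel c y x" if "parallel c x y" for x y
  proof -
    have swap: "{fst y, fst x} = {fst x, fst y}" "{snd y, snd x} = {snd x, snd y}"
      by (rule insert_commute)+
    show ?thesis
      using that unfolding parallel_def swap by auto
  qed
  have irrefl: "\<not> parallel c x x" for x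
    by (simp add: parallel_def)
  have "\<exists>S\<subseteq>arcs n. S \<noteq> {} \<and> (\<forall>x\<in>S. k \<le> card {y\<in>S. parallel c x y})"
    unfolding k_def
    by (rule min_degree_subgraph[OF finite_arcs \<open>arcs n \<noteq> {}\<close>]) (erule par_sym, rule irrefl)
  then obtain S where S: "S \<subseteq> arcs n" "S \<noteq> {}" and "\<forall>x\<in>S. k \<le> card {y\<in>S. parallel c x y}"
    by (elim exE conjE)
  then have deg: "k \<le> card {y\<in>S. parallel c x y}" if "x \<in> S" for x
    using that by simp
  have "k ^ 3 > 0"
    using dense by (rule le_less_trans[rotated]) simp
  then have "k > 0"
    by (simp add: zero_less_power_eq)
  interpret conflict_graph S "parallel c" touching 4 k
  proof
    show "finite S"
      using S(1) finite_arcs by (rule finite_subset)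
    show "real (card {z \<in> S. parallel c x z \<and> touching z y}) \<le> 4" if "x \<in> S" for x y
      using few_touching[OF proper S(1) that, of y] by simp
    show "S \<noteq> {}" "0 < k" "(0::real) < 4"
      using S \<open>k > 0\<close> by simp_all
    show "parallel c y x" if "parallel c x y" for x y
      using that by (rule par_sym)
    show "k \<le> real (card {y \<in> S. parallel c x y})" if "x \<in> S" for x
      using that by (rule deg)
  qed (auto simp: touching_def parallel_def)
  have "81 * 4\<^sup>2 * real (card S) \<le> 1296 * card (arcs n)"
    using card_mono[OF _ S(1)] by simp
  then have "81 * 4\<^sup>2 * real (card S) < k ^ 3"
    using dense by simp
  then show ?thesis
  proof (rule conflict_free_hexagon)
    fix x0 x1 x2 x3 x4 x5
    assume hex: "x0 \<in> S" "x1 \<in> S" "x2 \<in> S" "x3 \<in> S" "x4 \<in> S" "x5 \<in> S"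
      "parallel c x0 x1" "parallel c x1 x2" "parallel c x2 x3" "parallel c x3 x4" "parallel c x4 x5"
      "parallel c x5 x0"
      "\<not> touching x0 x2" "\<not> touching x1 x3" "\<not> touching x2 x4" "\<not> touching x3 x5" "\<not> touching x4 x0"
      "\<not> touching x5 x1" "\<not> touching x0 x3" "\<not> touching x1 x4" "\<not> touching x2 x5"
    \<comment> \<open>Consecutive pairs are disjoint because they are parallel; the remaining facts
      are turned around so that all 15 have increasing indices.\<close>
    have hex': "\<not> touching x0 x1" "\<not> touching x1 x2" "\<not> touching x2 x3" "\<not> touching x3 x4"
      "\<not> touching x4 x5" "\<not> touching x0 x5" "\<not> touching x0 x4" "\<not> touching x1 x5"
      using hex adj_not_sim sim_sym by blast+
    define x where "x = (!) [x0, x1, x2, x3, x4, x5]"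
    have less_6: "i = 0 \<or> i = 1 \<or> i = 2 \<or> i = 3 \<or> i = 4 \<or> i = 5" if "i < 6" for i :: nat
      using that by linarith
    show ?thesis
    proof (rule hexagon_two_repeat[of x])
      show "x i \<in> arcs n" if "i < 6" for i
      proof -
        have "x i \<in> S"
          using less_6[OF that] by (elim disjE) (simp_all add: x_def hex(1-6))
        then show ?thesis
          using S(1) by (rule subsetD[rotated])
      qed
      show "parallel c (x i) (x (Suc i mod 6))" if "i < 6" for i
        using less_6[OF that] by (elim disjE) (simp_all add: x_def hex(7-12))
      have sep: "\<not> touching (x i) (x j)" if "i < j" "j < 6" for i j
      proof -
        have "i < 6"
          using that by simp
        from less_6[OF this] less_6[OF that(2)] that(1) show ?thesis
          by (elim disjE) (simp_all add: x_def hex(13-) hex')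
      qed
      show "\<not> touching (x i) (x j)" if "i < 6" "j < 6" "i \<noteq> j" for i j
        using that sep[of i j] sep[of j i] sim_sym by (metis linorder_neqE_nat)
    qed
  qed
qed

lemma colours_ge_of_no_two_repeat:
  assumes proper: "proper_colouring (complete_graph n) c" and n: "n \<ge> 2"
    and no_repeat: "\<not> has_two_repeat (complete_graph n) c (cycle_graph 6)"
  shows "real n powr (4 / 3) \<le> 48 * card (c ` edges (complete_graph n))"
proof -
  define P where "P = real (card (arcs n))"
  define C where "C = real (card (c ` edges (complete_graph n)))"
  define M where "M = (\<Sum>x\<in>arcs n. real (card {y\<in>arcs n. parallel c x y}))"
  \<comment> \<open>\<open>P\<close> is about \<open>n\<^sup>2\<close>, so the target order
    \<open>n powr (4 / 3)\<close> is that of \<open>r\<^sup>2\<close>.\<close>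
  define r where "r = P powr (1 / 3)"
  have P_eq: "P = real n * (real n - 1)"
    using n by (simp add: P_def card_arcs of_nat_diff)
  have "real n * 1 \<le> P"
    unfolding P_eq using n by (intro mult_left_mono) auto
  then have P: "P \<ge> 2"
    using n by simp
  then have r: "r \<ge> 1"
    unfolding r_def by (intro ge_one_powr_ge_zero) auto
  have "r ^ 3 = r powr 3"
    using r by simp
  also have "\<dots> = P"
    unfolding r_def powr_powr using P by simp
  finally have r3: "r ^ 3 = P" .
  have "(M / (2 * P)) ^ 3 \<le> 1296 * P"
    by (rule ccontr) (use two_repeat_of_many_parallel[OF proper n] no_repeat in \<open>simp add: M_def P_def not_le\<close>)
  \<comment> \<open>\<open>11 ^ 3 = 1331\<close> exceeds 1296.\<close>
  also have "\<dots> \<le> (11 * r) ^ 3"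
    using P by (simp add: power_mult_distrib r3)
  finally have "M / (2 * P) \<le> 11 * r"
    using r P by (subst (asm) power_mono_iff) (auto simp: M_def sum_nonneg)
  then have M: "M \<le> 22 * r * P"
    using P by (simp add: field_simps)
  have "P\<^sup>2 \<le> C * (M + 2 * P)"
    using parallel_count[OF proper] by (simp add: P_def C_def M_def)
  \<comment> \<open>As \<open>r \<ge> 1\<close>, the exceptional term \<open>2 * P\<close> is
    absorbed, giving the factor 24.\<close>
  also have "\<dots> \<le> C * (22 * r * P + 2 * (r * P))"
    using M r P by (intro mult_left_mono add_mono) (auto simp: C_def)
  finally have "P * P \<le> (24 * r * C) * P"
    by (simp add: power2_eq_square algebra_simps)
  then have "r ^ 3 \<le> 24 * r * C"
    using P r3 by simp
  then have "r * (r\<^sup>2) \<le> r * (24 * C)"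
    by (simp add: power3_eq_cube power2_eq_square mult_ac)
  then have r2: "r\<^sup>2 \<le> 24 * C"
    using r by simp
  have "real n * real n \<le> real n * (2 * (real n - 1))"
    using n by (intro mult_left_mono) auto
  then have "(real n)\<^sup>2 \<le> 2 * P"
    by (simp add: P_eq power2_eq_square algebra_simps)
  then have "((real n)\<^sup>2) powr (2 / 3) \<le> (2 * P) powr (2 / 3)"
    by (intro powr_mono2) auto
  moreover have "((real n)\<^sup>2) powr (2 / 3) = (real n powr 2) powr (2 / 3)"
    using n by simp
  moreover have "(real n powr 2) powr (2 / 3) = real n powr (4 / 3)"
    unfolding powr_powr by simp
  moreover have "P powr (2 / 3) = r powr 2"
    unfolding r_def powr_powr by simp
  moreover have "r powr 2 = r\<^sup>2"
    using r by simp
  ultimately have "real n powr (4 / 3) \<le> 2 powr (2 / 3) * r\<^sup>2"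
    using P by (simp only: powr_mult)
  \<comment> \<open>Rounding the exponent \<open>2 / 3\<close> up to 1 turns 24 into the final
    48.\<close>
  also have "\<dots> \<le> 2 powr 1 * r\<^sup>2"
    by (intro mult_right_mono powr_mono) auto
  also have "\<dots> \<le> 48 * C"
    using r2 by simp
  finally show ?thesis
    by (simp add: C_def)
qed

theorem theorem4p4:
  "(\<lambda>n. real (f2 n (cycle_graph 6))) \<in> \<Omega>(\<lambda>n. real n powr (4 / 3))"
proof (rule landau_omega.bigI)
  show "(1 / 48 :: real) > 0"
    by simp
  show "\<forall>\<^sub>F n in sequentially.
      1 / 48 * norm (real n powr (4 / 3)) \<le> norm (real (f2 n (cycle_graph 6)))"
    using eventually_ge_at_top[of 2]
  proof eventually_elim
    case (elim n)
    have "edges (cycle_graph 6) = (\<lambda>i. {i, Suc i mod 6}) ` {..<6}"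
      by (simp add: cycle_graph_def setcompr_eq_image lessThan_def)
    then have "edges (cycle_graph 6) \<noteq> {}"
      by (simp only: image_is_empty lessThan_empty_iff)
    \<comment> \<open>The bound holds for every admissible colouring, hence for one that attains
      \<open>f2\<close>.\<close>
    then obtain c :: "nat set \<Rightarrow> nat" where c: "proper_colouring (complete_graph n) c"
      "card (c ` edges (complete_graph n)) = f2 n (cycle_graph 6)"
      "\<not> has_two_repeat (complete_graph n) c (cycle_graph 6)"
      by (rule f2_attained[OF simple_cycle_graph_6, where n = n])
    have "real n powr (4 / 3) \<le> 48 * real (f2 n (cycle_graph 6))"
      using colours_ge_of_no_two_repeat[OF c(1) elim c(3)] unfolding c(2) by simp
    moreover have "norm (real n powr (4 / 3)) = real n powr (4 / 3)"
      by simp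
    ultimately show ?case
      by simp
  qed
qed

end
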